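(* Let $n\geq 0$ and $k\geq 1$ be integers, let $\alpha_0,\dots,\alpha_{n-1}$ be non-zero real numbers and let $\ell_1,\dots,\ell_k$ be non-zero real numbers. Define $$C_{n,L}^{(k)}(\overline{\alpha})=\int_0^{\ell_1}\cdots\int_0^{\ell_k}\prod_{i=0}^{n-1}\left(x_1x_2\cdots x_k-\alpha_i\right)\,dx_1\cdots dx_k .$$ Then $$C_{n,L}^{(k)}(\overline{\alpha})=(-1)^n\prod_{i=0}^{n-1}\alpha_i\sum_{m=0}^{n}\frac{P_m\!\left(-H_{n,\overline{\alpha}}^{(1)},-H_{n,\overline{\alpha}}^{(2)},\dots,-H_{n,\overline{\alpha}}^{(m)}\right)}{(m+1)^k}\left(\ell_1\ell_2\cdots\ell_k\right)^{m+1}.$$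
   Context: The generalized harmonic numbers are $H_{n,\overline{\alpha}}^{(j)}=\sum_{i=0}^{n-1}\alpha_i^{-j}$. The modified Bell polynomials are $P_0=1$ and, for $m\geq1$, $P_m(x_1,\dots,x_m)=\sum \prod_{j=1}^{m}\frac{1}{k_j!}\left(\frac{x_j}{j}\right)^{k_j}$, the sum running over all tuples of non-negative integers $(k_1,\dots,k_m)$ with $k_1+2k_2+\cdots+mk_m=m$. *)

theory Defs
  imports "HOL-Analysis.Analysis"
begin

text \<open>
  \<open>iterated_integral [l1, ..., lk] f\<close> is the iterated integral of \<open>f [x1, ..., xk]\<close> with
  \<open>xj\<close> running from \<open>0\<close> to \<open>lj\<close>, where the first variable is the outermost one.
  The interval integral is oriented, so negative \<open>lj\<close> contribute
  \<open>- \<integral>\<close> over \<open>[lj, 0]\<close>.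
\<close>
primrec iterated_integral :: "real list \<Rightarrow> (real list \<Rightarrow> real) \<Rightarrow> real" where
  "iterated_integral [] f = f []"
| "iterated_integral (l # ls) f =
     (LBINT x=ereal 0..ereal l. iterated_integral ls (\<lambda>xs. f (x # xs)))"

definition multi_cauchy :: "nat \<Rightarrow> nat \<Rightarrow> (nat \<Rightarrow> real) \<Rightarrow> (nat \<Rightarrow> real) \<Rightarrow> real" where
  "multi_cauchy n k L \<alpha> =
     iterated_integral (map L [1..<Suc k]) (\<lambda>xs. \<Prod>i<n. (prod_list xs - \<alpha> i))"

definition gen_harmonic :: "nat \<Rightarrow> (nat \<Rightarrow> real) \<Rightarrow> nat \<Rightarrow> real" where
  "gen_harmonic n \<alpha> j = (\<Sum>i<n. \<alpha> i powi (- int j))"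

text \<open>
  The tuples \<open>(k_1, ..., k_m)\<close> are represented by the extensional functions on \<open>{1..m}\<close>,
  so that each tuple occurs exactly once.
\<close>
definition weighted_tuples :: "nat \<Rightarrow> (nat \<Rightarrow> nat) set" where
  "weighted_tuples m = {k \<in> {1..m} \<rightarrow>\<^sub>E UNIV. (\<Sum>j=1..m. j * k j) = m}"

definition modified_bell :: "nat \<Rightarrow> (nat \<Rightarrow> real) \<Rightarrow> real" where
  "modified_bell m x =
     (\<Sum>k\<in>weighted_tuples m. \<Prod>j=1..m. 1 / fact (k j) * (x j / real j) ^ k j)"

lemma finite_weighted_tuples: "finite (weighted_tuples m)"
proof (rule finite_subset)
  show "weighted_tuples m \<subseteq> {1..m} \<rightarrow>\<^sub>E {..m}"
  proof
    fix k assume k: "k \<in> weighted_tuples m"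
    have "k j \<le> m" if j: "j \<in> {1..m}" for j
    proof -
      have "k j \<le> j * k j" using j by simp
      also have "\<dots> \<le> (\<Sum>j=1..m. j * k j)" using j by (intro member_le_sum) auto
      also have "\<dots> = m" using k by (simp add: weighted_tuples_def)
      finally show ?thesis .
    qed
    with k show "k \<in> {1..m} \<rightarrow>\<^sub>E {..m}"
      by (auto simp: weighted_tuples_def PiE_iff)
  qed
  show "finite ({1..m} \<rightarrow>\<^sub>E {..m})" by (intro finite_PiE) auto
qed

lemma modified_bell_0 [simp]: "modified_bell 0 x = 1"
  by (simp add: modified_bell_def weighted_tuples_def)

end

theory Submission
  imports Defs "HOL-Computational_Algebra.Polynomial_FPS"
begin

text \<open>
  Write \<open>y\<close> for \<open>x\<^sub>1 \<cdots> x\<^sub>k\<close>. Since \<open>\<Prod>\<^sub>i (y - \<alpha>\<^sub>i) = (-1)\<^sup>n (\<Prod>\<^sub>i \<alpha>\<^sub>i) \<Prod>\<^sub>i (1 - y / \<alpha>\<^sub>i)\<close>, it suffices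
  that the coefficients of \<open>G = \<Prod>\<^sub>i (1 - X / \<alpha>\<^sub>i)\<close> are the modified Bell polynomials at the
  negated power sums of the \<open>1 / \<alpha>\<^sub>i\<close>. Both sequences start with \<open>1\<close> and satisfy Newton's recurrence
  \<open>m a\<^sub>m = \<Sum>\<^sub>j x\<^sub>j a\<^sub>m\<^sub>-\<^sub>j\<close>: for \<open>G\<close> it expresses its logarithmic derivative, and for the Bell polynomials
  it results from \<open>m = \<Sum>\<^sub>j j k\<^sub>j\<close> by lowering \<open>k\<^sub>j\<close> by one. Integrating monomials finishes the proof.
\<close>

subsection \<open>Newton's recurrence for the modified Bell polynomials\<close>

text \<open>
  Decoupling the range \<open>{1..M}\<close> of the indices from the weight \<open>m\<close> lets the
  tuples of different weights live on a common index set.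
\<close>
definition bounded_tuples :: "nat \<Rightarrow> nat \<Rightarrow> (nat \<Rightarrow> nat) set" where
  "bounded_tuples M m = {k \<in> {1..M} \<rightarrow>\<^sub>E UNIV. (\<Sum>j=1..M. j * k j) = m}"

definition bell_term :: "nat \<Rightarrow> (nat \<Rightarrow> real) \<Rightarrow> (nat \<Rightarrow> nat) \<Rightarrow> real" where
  "bell_term M x k = (\<Prod>j=1..M. 1 / fact (k j) * (x j / real j) ^ k j)"

lemma bounded_tuples_index_le:
  assumes "k \<in> bounded_tuples M m" "j \<in> {1..M}"
  shows "j * k j \<le> m"
proof -
  have "j * k j \<le> (\<Sum>j=1..M. j * k j)" using assms(2) by (intro member_le_sum) auto
  with assms(1) show ?thesis by (simp add: bounded_tuples_def)
qed

lemma bounded_tuples_eq_0: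
  assumes "k \<in> bounded_tuples M m" "j \<in> {1..M}" "m < j"
  shows "k j = 0"
proof (rule ccontr)
  assume "k j \<noteq> 0"
  then have "j \<le> j * k j" by simp
  with bounded_tuples_index_le[OF assms(1,2)] assms(3) show False by simp
qed

lemma finite_bounded_tuples: "finite (bounded_tuples M m)"
proof (rule finite_subset)
  show "bounded_tuples M m \<subseteq> {1..M} \<rightarrow>\<^sub>E {..m}"
  proof
    fix k assume k: "k \<in> bounded_tuples M m"
    have "k j \<le> m" if j: "j \<in> {1..M}" for j
    proof -
      have "k j \<le> j * k j" using j by simp
      also note bounded_tuples_index_le[OF k j]
      finally show ?thesis .
    qed
    with k show "k \<in> {1..M} \<rightarrow>\<^sub>E {..m}" by (auto simp: bounded_tuples_def PiE_iff)
  qed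
  show "finite ({1..M} \<rightarrow>\<^sub>E {..m})" by (intro finite_PiE) auto
qed

text \<open>A tuple of weight \<open>m\<close> vanishes at every index above \<open>m\<close>, and a
  zero entry contributes the factor 1. Padding with zeros and restricting to \<open>{1..m}\<close>
  are therefore inverse bijections that preserve the summands.\<close>

lemma modified_bell_bounded:
  assumes "m \<le> M"
  shows "modified_bell m x = (\<Sum>k\<in>bounded_tuples M m. bell_term M x k)"
proof -
  define ext where "ext k = (\<lambda>j\<in>{1..M}. if j \<le> m then k j else 0)" for k :: "nat \<Rightarrow> nat"
  have sub: "{1..m} \<subseteq> {1..M}" using assms by auto
  have sum_ext: "(\<Sum>j=1..M. j * ext k j) = (\<Sum>j=1..m. j * k j)" for k
    using sub by (intro sum.mono_neutral_cong_right) (auto simp: ext_def)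
  have sum_restrict: "(\<Sum>j=1..m. j * restrict k {1..m} j) = m" if k: "k \<in> bounded_tuples M m" for k
  proof -
    have "(\<Sum>j=1..m. j * restrict k {1..m} j) = (\<Sum>j=1..M. j * k j)"
      using sub bounded_tuples_eq_0[OF k] by (intro sum.mono_neutral_cong_left) auto
    with k show ?thesis by (simp add: bounded_tuples_def)
  qed
  show ?thesis
    unfolding modified_bell_def
  proof (rule sum.reindex_bij_witness[where i = "\<lambda>k. restrict k {1..m}" and j = ext])
    fix k assume k: "k \<in> weighted_tuples m"
    show "restrict (ext k) {1..m} = k"
      using k sub by (auto simp: weighted_tuples_def ext_def fun_eq_iff PiE_iff extensional_def)
    show "ext k \<in> bounded_tuples M m"
      using k sum_ext[of k] by (auto simp: weighted_tuples_def bounded_tuples_def ext_def)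
    show "bell_term M x (ext k) = (\<Prod>j=1..m. 1 / fact (k j) * (x j / real j) ^ k j)"
      unfolding bell_term_def
      using sub by (intro prod.mono_neutral_cong_right) (auto simp: ext_def)
  next
    fix k assume k: "k \<in> bounded_tuples M m"
    show "ext (restrict k {1..m}) = k"
      using k bounded_tuples_eq_0[OF k]
      by (auto simp: bounded_tuples_def ext_def fun_eq_iff PiE_iff extensional_def)
    show "restrict k {1..m} \<in> weighted_tuples m"
      using sum_restrict[OF k] by (simp add: weighted_tuples_def)
  qed
qed

text \<open>Only the factor at \<open>j\<close> changes: \<open>Suc (k j)\<close> cancels against
  the factorial, and \<open>j\<close> against the denominator of one copy of
  \<open>x j / real j\<close>.\<close>

lemma bell_term_Suc:
  assumes "j \<in> {1..M}"
  shows "real (j * Suc (k j)) * bell_term M x (k(j := Suc (k j))) = x j * bell_term M x k"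
proof -
  have "bell_term M x k' = 1 / fact (k' j) * (x j / real j) ^ k' j *
      (\<Prod>i\<in>{1..M} - {j}. 1 / fact (k' i) * (x i / real i) ^ k' i)" for k'
    unfolding bell_term_def using assms by (intro prod.remove) auto
  moreover have "(\<Prod>i\<in>{1..M} - {j}. 1 / fact ((k(j := Suc (k j))) i) *
        (x i / real i) ^ ((k(j := Suc (k j))) i)) =
      (\<Prod>i\<in>{1..M} - {j}. 1 / fact (k i) * (x i / real i) ^ k i)"
    by (intro prod.cong) auto
  moreover have "real (j * Suc (k j)) * (1 / fact (Suc (k j)) * (x j / real j) ^ Suc (k j)) =
      x j * (1 / fact (k j) * (x j / real j) ^ k j)"
  proof -
    have "real (Suc (k j)) / fact (Suc (k j)) = 1 / fact (k j)"
      by (simp add: fact_Suc del: of_nat_Suc)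
    moreover have "real j * (x j / real j) = x j" using assms by simp
    moreover have "real (j * Suc (k j)) * (1 / fact (Suc (k j)) * (x j / real j) ^ Suc (k j)) =
        real (Suc (k j)) / fact (Suc (k j)) * (real j * (x j / real j)) * (x j / real j) ^ k j"
      by (simp only: of_nat_mult power_Suc divide_inverse mult_1 mult_ac)
    ultimately show ?thesis by (simp only: mult_ac)
  qed
  ultimately show ?thesis by (simp only: fun_upd_same mult.assoc[symmetric])
qed

lemma sum_fun_upd_Suc:
  fixes k :: "nat \<Rightarrow> nat"
  assumes "j \<in> {1..M}"
  shows "(\<Sum>i=1..M. i * (k(j := Suc (k j))) i) = (\<Sum>i=1..M. i * k i) + j"
proof -
  have "(\<Sum>i=1..M. i * (k(j := Suc (k j))) i) = (\<Sum>i=1..M. i * k i + (if i = j then j else 0))"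
    by (intro sum.cong) auto
  with assms show ?thesis by (simp add: sum.distrib)
qed

text \<open>Tuples with \<open>k j = 0\<close> contribute nothing; on the others, lowering
  \<open>k j\<close> by one is a bijection onto the tuples of weight \<open>m - j\<close>.\<close>

lemma sum_bell_term_lower:
  assumes "j \<in> {1..M}" "j \<le> m"
  shows "(\<Sum>k\<in>bounded_tuples M m. real (j * k j) * bell_term M x k) =
    x j * (\<Sum>k\<in>bounded_tuples M (m - j). bell_term M x k)"
proof -
  have "(\<Sum>k\<in>bounded_tuples M m. real (j * k j) * bell_term M x k) =
      (\<Sum>k\<in>{k \<in> bounded_tuples M m. k j \<noteq> 0}. real (j * k j) * bell_term M x k)"
    by (intro sum.mono_neutral_right) (auto simp: finite_bounded_tuples)
  also have "\<dots> = (\<Sum>k\<in>bounded_tuples M (m - j). x j * bell_term M x k)"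
  proof (rule sum.reindex_bij_witness[where i = "\<lambda>k. k(j := Suc (k j))"
        and j = "\<lambda>k. k(j := k j - 1)"])
    fix k assume k: "k \<in> {k \<in> bounded_tuples M m. k j \<noteq> 0}"
    let ?k = "k(j := k j - 1)"
    show eq: "?k(j := Suc (?k j)) = k" using k by (auto simp: fun_eq_iff)
    show "?k \<in> bounded_tuples M (m - j)"
      using k sum_fun_upd_Suc[OF assms(1), of ?k] assms(1) unfolding eq
      by (auto simp: bounded_tuples_def PiE_iff extensional_def)
    show "x j * bell_term M x ?k = real (j * k j) * bell_term M x k"
    proof -
      have "Suc (?k j) = k j" using k by simp
      with bell_term_Suc[OF assms(1), of ?k x] show ?thesis unfolding eq by simp
    qed
  next
    fix k assume k: "k \<in> bounded_tuples M (m - j)"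
    show "(k(j := Suc (k j)))(j := (k(j := Suc (k j))) j - 1) = k" by simp
    show "k(j := Suc (k j)) \<in> {k \<in> bounded_tuples M m. k j \<noteq> 0}"
      using k sum_fun_upd_Suc[OF assms(1), of k] assms
      by (auto simp: bounded_tuples_def PiE_iff extensional_def)
  qed
  finally show ?thesis by (simp add: sum_distrib_left)
qed

lemma modified_bell_newton:
  "real m * modified_bell m x = (\<Sum>j=1..m. x j * modified_bell (m - j) x)"
proof -
  have "real m * modified_bell m x =
      (\<Sum>k\<in>bounded_tuples m m. real (\<Sum>j=1..m. j * k j) * bell_term m x k)"
    unfolding modified_bell_bounded[OF order_refl] sum_distrib_left
    by (intro sum.cong) (auto simp: bounded_tuples_def)
  also have "\<dots> = (\<Sum>j=1..m. \<Sum>k\<in>bounded_tuples m m. real (j * k j) * bell_term m x k)"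
    unfolding of_nat_sum sum_distrib_right by (rule sum.swap)
  also have "\<dots> = (\<Sum>j=1..m. x j * modified_bell (m - j) x)"
    \<comment> \<open>The common index set \<open>{1..m}\<close> is large enough for every weight
      \<open>m - j\<close>.\<close>
    by (intro sum.cong refl)
      (auto simp: sum_bell_term_lower modified_bell_bounded[of _ m] simp del: of_nat_mult)
  finally show ?thesis .
qed

text \<open>For \<open>m > 0\<close> the factor \<open>real m\<close> cancels, so the recurrence
  determines each value from the earlier ones; at \<open>m = 0\<close> it is vacuous, hence the
  separate initial value.\<close>

lemma modified_bell_unique:
  assumes "a 0 = 1" and "\<And>m. real m * a m = (\<Sum>j=1..m. x j * a (m - j))"
  shows "a m = modified_bell m x"
proof (induction m rule: less_induct)
  case (less m)
  show ?case
  proof (cases "m = 0")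
    case False
    have "(\<Sum>j=1..m. x j * a (m - j)) = (\<Sum>j=1..m. x j * modified_bell (m - j) x)"
      using less False by (intro sum.cong) auto
    then have "real m * a m = real m * modified_bell m x"
      by (simp only: assms(2) modified_bell_newton)
    with False show ?thesis by simp
  qed (simp add: assms(1))
qed

subsection \<open>Expansion of the product\<close>

text \<open>This is \<open>fps_X\<close> times the logarithmic derivative of the product of the
  factors \<open>1 - z i * X\<close>.\<close>

definition neg_power_sums :: "nat \<Rightarrow> (nat \<Rightarrow> real) \<Rightarrow> real fps" where
  "neg_power_sums n z = Abs_fps (\<lambda>j. if j = 0 then 0 else - (\<Sum>i<n. z i ^ j))"

text \<open>The geometric series for \<open>- c X / (1 - c X)\<close>, with the denominator cleared
  so that no division of series occurs.\<close>

lemma geometric_fps_mult: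
  "Abs_fps (\<lambda>j. if j = 0 then 0 else - (c ^ j)) * (1 - fps_const c * fps_X) =
    - (fps_const c * fps_X)" for c :: real
proof (rule fps_ext)
  fix m
  let ?T = "Abs_fps (\<lambda>j. if j = 0 then 0 else - (c ^ j))"
  have "?T * (1 - fps_const c * fps_X) = ?T - fps_const c * (fps_X * ?T)"
    by (simp add: algebra_simps)
  then show "fps_nth (?T * (1 - fps_const c * fps_X)) m = fps_nth (- (fps_const c * fps_X)) m"
    by (cases m) auto
qed

text \<open>Logarithmic derivatives add over products: by the product rule, each new factor adds its
  own geometric series.\<close>

lemma fps_deriv_prod_linear:
  "fps_X * fps_deriv (\<Prod>i<n. 1 - fps_const (z i) * fps_X) =
    neg_power_sums n z * (\<Prod>i<n. 1 - fps_const (z i) * fps_X)"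
proof (induction n)
  case 0
  have "neg_power_sums 0 z = 0" by (auto simp: neg_power_sums_def fps_eq_iff)
  then show ?case by simp
next
  case (Suc n)
  let ?G = "\<Prod>i<n. 1 - fps_const (z i) * fps_X"
  let ?f = "1 - fps_const (z n) * fps_X"
  let ?T = "Abs_fps (\<lambda>j. if j = 0 then 0 else - (z n ^ j))"
  have S: "neg_power_sums (Suc n) z = neg_power_sums n z + ?T"
    by (auto simp: neg_power_sums_def fps_eq_iff)
  have "fps_X * fps_deriv (?G * ?f) = (fps_X * fps_deriv ?G) * ?f + ?G * (- (fps_const (z n) * fps_X))"
    by (simp add: algebra_simps)
  also have "\<dots> = neg_power_sums n z * ?G * ?f + ?G * (?T * ?f)"
    by (simp only: Suc geometric_fps_mult)
  also have "\<dots> = neg_power_sums (Suc n) z * (?G * ?f)"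
    unfolding S by (simp add: algebra_simps)
  finally show ?case by simp
qed

lemma prod_linear_nth:
  fixes n :: nat
  shows "fps_nth (\<Prod>i<n. 1 - fps_const (z i) * fps_X) m = modified_bell m (\<lambda>j. - (\<Sum>i<n. z i ^ j))"
proof (rule modified_bell_unique)
  let ?G = "\<Prod>i<n. 1 - fps_const (z i) * fps_X"
  show "fps_nth ?G 0 = 1" by (induction n) auto
  fix m
  have "real m * fps_nth ?G m = fps_nth (fps_X * fps_deriv ?G) m" by (cases m) auto
  also have "\<dots> = (\<Sum>j=0..m. fps_nth (neg_power_sums n z) j * fps_nth ?G (m - j))"
    by (simp add: fps_deriv_prod_linear fps_mult_nth)
  also have "\<dots> = (\<Sum>j=1..m. - (\<Sum>i<n. z i ^ j) * fps_nth ?G (m - j))"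
    \<comment> \<open>The constant coefficient of \<open>neg_power_sums\<close> is 0, so the sum
      starts at 1.\<close>
    by (intro sum.mono_neutral_cong_right) (auto simp: neg_power_sums_def)
  finally show "real m * fps_nth ?G m = (\<Sum>j=1..m. - (\<Sum>i<n. z i ^ j) * fps_nth ?G (m - j))" .
qed

text \<open>The polynomial \<open>p\<close> links the formal series, which gives its coefficients,
  with evaluation at \<open>y\<close>; its degree bound cuts the sum off at
  \<open>n\<close>.\<close>

lemma prod_one_minus_expansion:
  fixes y :: real
  shows "(\<Prod>i<n. 1 - z i * y) = (\<Sum>m\<le>n. modified_bell m (\<lambda>j. - (\<Sum>i<n. z i ^ j)) * y ^ m)"
proof -
  define p where "p = (\<Prod>i<n. [:1, - z i:])"
  have deg: "degree p \<le> n"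
    using degree_prod_sum_le[of "{..<n}" "\<lambda>i. [:1, - z i:]"]
      sum_bounded_above[of "{..<n}" "\<lambda>i. degree [:1, - z i:]" 1]
    by (force simp: p_def)
  have "fps_of_poly p = (\<Prod>i<n. 1 - fps_const (z i) * fps_X)"
    by (simp add: p_def fps_of_poly_prod fps_of_poly_pCons mult.commute flip: fps_const_neg)
  then have coeff: "coeff p m = modified_bell m (\<lambda>j. - (\<Sum>i<n. z i ^ j))" for m
    using prod_linear_nth[of z n m] by (metis fps_of_poly_nth)
  have "(\<Prod>i<n. 1 - z i * y) = poly p y"
    by (simp add: p_def poly_prod mult.commute)
  also have "\<dots> = (\<Sum>m\<le>n. coeff p m * y ^ m)"
    unfolding poly_altdef using deg
    by (intro sum.mono_neutral_left) (auto simp: coeff_eq_0)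
  finally show ?thesis by (simp only: coeff)
qed

lemma prod_minus_expansion:
  fixes y :: real
  assumes "\<And>i. i < n \<Longrightarrow> \<alpha> i \<noteq> 0"
  shows "(\<Prod>i<n. y - \<alpha> i) = (-1) ^ n * (\<Prod>i<n. \<alpha> i) *
    (\<Sum>m\<le>n. modified_bell m (\<lambda>j. - gen_harmonic n \<alpha> j) * y ^ m)"
proof -
  have "(\<Prod>i<n. y - \<alpha> i) = (\<Prod>i<n. - 1 * \<alpha> i * (1 - inverse (\<alpha> i) * y))"
    using assms by (intro prod.cong) (auto simp: field_simps)
  also have "\<dots> = (-1) ^ n * (\<Prod>i<n. \<alpha> i) * (\<Prod>i<n. 1 - inverse (\<alpha> i) * y)"
    by (simp only: prod.distrib prod_constant card_lessThan)
  \<comment> \<open>The harmonic numbers are the power sums of the inverses, so the previous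
    expansion applies with \<open>z i = inverse (\<alpha> i)\<close>.\<close>
  also have "gen_harmonic n \<alpha> = (\<lambda>j. \<Sum>i<n. inverse (\<alpha> i) ^ j)"
    by (auto simp: gen_harmonic_def power_int_minus power_inverse)
  ultimately show ?thesis by (simp only: prod_one_minus_expansion)
qed

subsection \<open>Iterated integrals of polynomials in the product of the variables\<close>

lemma interval_integral_polynomial:
  fixes c :: "nat \<Rightarrow> real"
  shows "(LBINT x=ereal 0..ereal l. (\<Sum>m\<le>n. c m * x ^ m)) =
    (\<Sum>m\<le>n. c m / (real m + 1) * l ^ (m + 1))"
proof -
  have "((\<lambda>x. \<Sum>m\<le>n. c m / (real m + 1) * x ^ (m + 1)) has_real_derivative
      (\<Sum>m\<le>n. c m * x ^ m)) (at x within A)" for x :: real and A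
  proof (rule DERIV_sum)
    fix m
    show "((\<lambda>x. c m / (real m + 1) * x ^ (m + 1)) has_real_derivative c m * x ^ m) (at x within A)"
      using DERIV_cmult[OF DERIV_pow[of "m + 1" x A], of "c m / (real m + 1)"]
      by (simp add: add.commute)
  qed
  then have "(LBINT x=ereal 0..ereal l. (\<Sum>m\<le>n. c m * x ^ m)) =
      (\<Sum>m\<le>n. c m / (real m + 1) * l ^ (m + 1)) - (\<Sum>m\<le>n. c m / (real m + 1) * 0 ^ (m + 1))"
    by (intro interval_integral_FTC_finite)
      (auto intro!: continuous_intros simp: has_real_derivative_iff_has_vector_derivative)
  then show ?thesis by simp
qed

text \<open>The induction generalises over \<open>c\<close>, because the outer variable
  \<open>x\<close> is absorbed into the coefficients as \<open>c m * x ^ m\<close>. The inner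
  integral is then a polynomial in \<open>x\<close>, and integrating it adds one more factor
  \<open>real m + 1\<close> to the denominator.\<close>

lemma iterated_integral_polynomial:
  "iterated_integral ls (\<lambda>xs. \<Sum>m\<le>n. c m * prod_list xs ^ m) =
    (\<Sum>m\<le>n. c m / (real m + 1) ^ length ls * prod_list ls ^ (m + 1))"
proof (induction ls arbitrary: c)
  case (Cons l ls)
  have "iterated_integral ls (\<lambda>xs. \<Sum>m\<le>n. c m * prod_list (x # xs) ^ m) =
      (\<Sum>m\<le>n. c m / (real m + 1) ^ length ls * prod_list ls ^ (m + 1) * x ^ m)" for x
    using Cons[of "\<lambda>m. c m * x ^ m"] by (simp add: power_mult_distrib mult_ac)
  then show ?case
    by (simp only: iterated_integral.simps interval_integral_polynomial)
      (simp add: power_mult_distrib mult_ac)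
qed simp

theorem theorem2p4:
  fixes n k :: nat and \<alpha> L :: "nat \<Rightarrow> real"
  assumes "k \<ge> 1"
    and "\<And>i. i < n \<Longrightarrow> \<alpha> i \<noteq> 0"
    and "\<And>j. j \<in> {1..k} \<Longrightarrow> L j \<noteq> 0"
  shows "multi_cauchy n k L \<alpha> =
    (-1) ^ n * (\<Prod>i<n. \<alpha> i) *
      (\<Sum>m=0..n. modified_bell m (\<lambda>j. - gen_harmonic n \<alpha> j) / (real m + 1) ^ k
                  * (\<Prod>j=1..k. L j) ^ (m + 1))"
proof -
  let ?b = "\<lambda>m. modified_bell m (\<lambda>j. - gen_harmonic n \<alpha> j)"
  let ?A = "(-1) ^ n * (\<Prod>i<n. \<alpha> i)"
  have "prod_list (map L [1..<Suc k]) = (\<Prod>j=1..k. L j)"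
    by (simp only: interv_sum_list_conv_sum_set_nat prod.distinct_set_conv_list[OF distinct_upt, symmetric]
        set_upt atLeastLessThanSuc_atLeastAtMost)
  moreover have "multi_cauchy n k L \<alpha> =
      iterated_integral (map L [1..<Suc k]) (\<lambda>xs. \<Sum>m\<le>n. ?A * ?b m * prod_list xs ^ m)"
    unfolding multi_cauchy_def
    by (simp only: prod_minus_expansion[OF assms(2)] sum_distrib_left mult.assoc)
  ultimately show ?thesis
    by (simp only: iterated_integral_polynomial length_map length_upt diff_Suc_1 sum_distrib_left
        atLeast0AtMost) (simp add: mult_ac)
qed

end
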